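(* Let $a>0$, $x_0\in\mathbb{R}$, $y_0\in\mathbb{R}^n$, and consider the Volterra integro-differential equation $$y'(x) = f(x,y(x)) + \int_{x_0}^x K(x,t,y(t))\,dt,\qquad y(x_0)=y_0.$$ Assume that $f$ and $K$ are continuous and that there are constants $L_1,L_2$ such that the Lipschitz conditions $$\|f(x,y_1)-f(x,y_2)\|\le L_1\|y_1-y_2\|,\qquad \|K(x,t,y_1)-K(x,t,y_2)\|\le L_2\|y_1-y_2\|$$ hold for every $x,t$ with $|x-x_0|\le a$, $|t-x_0|\le a$ and all $y_1,y_2\in\mathbb{R}^n$ (that is, for all $y_1,y_2$ with $\|y_1\|<\infty$, $\|y_2\|<\infty$). Then the initial value problem has a unique solution on $|x-x_0|\le a$.
   Context: Here $f=f(x,y)$ and $K=K(x,t,y)$ are $\mathbb{R}^n$-valued functions defined for $|x-x_0|\le a$, $|t-x_0|\le a$, $y\in\mathbb{R}^n$, and $\|\cdot\|$ is a norm on $\mathbb{R}^n$ (in the scalar case $n=1$, the absolute value). A solution is a differentiable function $y$ satisfying the equation and the initial condition. *)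

theory Defs
  imports "HOL-Analysis.Analysis"
begin

definition is_norm :: "('v::real_vector \<Rightarrow> real) \<Rightarrow> bool" where
  "is_norm N \<longleftrightarrow>
     (\<forall>v. 0 \<le> N v) \<and>
     (\<forall>v. N v = 0 \<longleftrightarrow> v = 0) \<and>
     (\<forall>c v. N (c *\<^sub>R v) = \<bar>c\<bar> * N v) \<and>
     (\<forall>v w. N (v + w) \<le> N v + N w)"

text \<open>
  Solutions on the compact interval with centre \<open>x0\<close> and radius \<open>a\<close>. The derivative is taken
  within the interval, so it is one-sided at the two end points. The integral is the oriented one:
  for \<open>x < x0\<close> it is minus the integral over the interval from \<open>x\<close> to \<open>x0\<close>. Values of \<open>y\<close>
  outside the interval play no role.
\<close>

definition volterra_ide_solution ::
  "(real \<Rightarrow> real ^ 'n \<Rightarrow> real ^ 'n) \<Rightarrow> (real \<Rightarrow> real \<Rightarrow> real ^ 'n \<Rightarrow> real ^ 'n) \<Rightarrow>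
   real \<Rightarrow> real ^ 'n \<Rightarrow> real \<Rightarrow> (real \<Rightarrow> real ^ 'n) \<Rightarrow> bool" where
  "volterra_ide_solution f K x0 y0 a y \<longleftrightarrow>
     y x0 = y0 \<and>
     (\<forall>x\<in>{x0 - a..x0 + a}.
        (y has_vector_derivative (f x (y x) + (LBINT t=x0..x. K x t (y t))))
          (at x within {x0 - a..x0 + a}))"

end

theory Submission
  imports Defs
begin

text \<open>
  The right-hand side of the equation is a map \<open>G\<close> on continuous functions: \<open>G y\<close> sends
  \<open>x\<close> to \<open>f x (y x)\<close> plus the integral of \<open>K x t (y t)\<close> over \<open>t\<close> from \<open>x0\<close> to \<open>x\<close>. The memory
  term reaches back only to \<open>x0\<close>, so \<open>G\<close> is causal: \<open>G y x\<close> depends on \<open>y\<close> only at points no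
  farther from \<open>x0\<close> than \<open>x\<close>, and if \<open>y\<close> and \<open>z\<close> differ there by at most \<open>d\<close>, then \<open>G y x\<close> and
  \<open>G z x\<close> differ by at most \<open>M * d\<close>, where \<open>M\<close> combines the two Lipschitz constants and the length
  of the interval (\<open>volterra_rhs_lipschitz\<close>). The problem becomes the functional differential
  equation \<open>y' = G y\<close>, and the locale \<open>causal_lipschitz\<close> solves it for every such \<open>G\<close>.

  Solutions are the fixed points of \<open>P\<close>, where \<open>P y x\<close> is \<open>y0\<close> plus the integral of \<open>G y\<close> from
  \<open>x0\<close> to \<open>x\<close>. In the supremum norm, \<open>P\<close> is sure to contract only on short intervals. In Bielecki's norm,
  the supremum of \<open>norm (y x)\<close> divided by \<open>exp (2 * M * \<bar>x - x0\<bar>)\<close>, it at least halves distances on the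
  whole interval (\<open>bielecki_contraction\<close>): integrating \<open>M\<close> times the weight away from \<open>x0\<close>
  returns at most half of the weight. Banach's fixed point theorem gives existence. For uniqueness,
  the weighted distance of two solutions is at most half of itself.

  Everything analytic is done in the Euclidean norm. A Lipschitz condition in an arbitrary norm \<open>N\<close>
  becomes one in the Euclidean norm, with another constant, since norms in finite dimension are
  equivalent (\<open>is_norm_equivalent\<close>). Both sides of \<open>x0\<close> are treated at once by moving along the
  segment from \<open>x0\<close> to \<open>x\<close>, parametrised by the unit interval (\<open>increment_bound_radial\<close>,
  \<open>oriented_integral_eq_integral_unit\<close>).
\<close>

section \<open>Functions along a segment from the base point\<close>

lemma segment_mem_convex:
  fixes x0 x :: real
  assumes "convex S" "x0 \<in> S" "x \<in> S" "r \<in> {0..1}"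
  shows "x0 + r * (x - x0) \<in> S"
proof -
  have "(1 - r) *\<^sub>R x0 + r *\<^sub>R x \<in> S"
    using assms by (intro convexD) auto
  then show ?thesis
    by (simp add: algebra_simps)
qed

lemma has_vector_derivative_along_segment:
  fixes F :: "real \<Rightarrow> 'a::real_normed_vector"
  assumes "convex S" "x0 \<in> S" "x \<in> S"
    and "\<And>t. t \<in> S \<Longrightarrow> (F has_vector_derivative F' t) (at t within S)"
    and "r \<in> {0..1}"
  shows "((\<lambda>r. F (x0 + r * (x - x0))) has_vector_derivative (x - x0) *\<^sub>R F' (x0 + r * (x - x0)))
           (at r within {0..1})"
proof -
  have mem: "x0 + s * (x - x0) \<in> S" if "s \<in> {0..1}" for s
    using segment_mem_convex[OF assms(1-3) that] .
  have "((\<lambda>r. x0 + r * (x - x0)) has_vector_derivative (x - x0)) (at r within {0..1})"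
    by (auto intro!: derivative_eq_intros)
  moreover have "(F has_vector_derivative F' (x0 + r * (x - x0)))
      (at (x0 + r * (x - x0)) within (\<lambda>r. x0 + r * (x - x0)) ` {0..1})"
    by (rule has_vector_derivative_within_subset[OF assms(4)[OF mem[OF assms(5)]]]) (use mem in auto)
  ultimately show ?thesis
    using vector_diff_chain_within by (force simp: o_def)
qed

text \<open>
  A mean value inequality: along the segment from \<open>x0\<close> to \<open>x\<close>, the function \<open>F\<close> moves no faster
  than the scalar majorant \<open>\<phi>\<close> of the distance from \<open>x0\<close>. The linear majorant gives the Lipschitz
  bound of the memory term, the exponential one the Bielecki estimate, and the zero one
  the uniqueness of antiderivatives.
\<close>
lemma increment_bound_radial:
  fixes F :: "real \<Rightarrow> 'a::real_normed_vector" and \<phi> \<phi>' :: "real \<Rightarrow> real"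
  assumes S: "convex S" "x0 \<in> S" "x \<in> S"
    and F: "\<And>t. t \<in> S \<Longrightarrow> (F has_vector_derivative F' t) (at t within S)"
    and \<phi>: "\<And>r. (\<phi> has_real_derivative \<phi>' r) (at r)"
    and le: "\<And>t. t \<in> S \<Longrightarrow> \<bar>t - x0\<bar> \<le> \<bar>x - x0\<bar> \<Longrightarrow> norm (F' t) \<le> \<phi>' \<bar>t - x0\<bar>"
  shows "norm (F x - F x0) \<le> \<phi> \<bar>x - x0\<bar> - \<phi> 0"
proof -
  define h where "h = (\<lambda>r. F (x0 + r * (x - x0)))"
  define \<psi> where "\<psi> = (\<lambda>r. \<phi> (r * \<bar>x - x0\<bar>))"
  have dh: "(h has_vector_derivative (x - x0) *\<^sub>R F' (x0 + r * (x - x0))) (at r within {0..1})"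
    if "r \<in> {0..1}" for r
    unfolding h_def using has_vector_derivative_along_segment[OF S F that] .
  have d\<psi>: "(\<psi> has_vector_derivative \<bar>x - x0\<bar> * \<phi>' (r * \<bar>x - x0\<bar>)) (at r)" for r
  proof -
    have "(\<psi> has_real_derivative \<phi>' (r * \<bar>x - x0\<bar>) * \<bar>x - x0\<bar>) (at r)"
      unfolding \<psi>_def by (rule DERIV_chain2[OF \<phi>]) (auto intro!: derivative_eq_intros)
    then show ?thesis
      by (simp add: has_real_derivative_iff_has_vector_derivative mult.commute)
  qed
  have "norm (h 1 - h 0) \<le> \<psi> 1 - \<psi> 0"
  proof (rule differentiable_bound_general)
    show "continuous_on {0..1} h"
      by (rule continuous_on_vector_derivative[OF dh])
    show "continuous_on {0..1} \<psi>"
      by (rule continuous_on_vector_derivative[OF has_vector_derivative_at_within[OF d\<psi>]])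
    show "(h has_vector_derivative (x - x0) *\<^sub>R F' (x0 + r * (x - x0))) (at r)"
      if "0 < r" "r < 1" for r
      using dh[of r] that at_within_Icc_at[of 0 r 1] by auto
    show "(\<psi> has_vector_derivative \<bar>x - x0\<bar> * \<phi>' (r * \<bar>x - x0\<bar>)) (at r)" for r
      by (rule d\<psi>)
    show "norm ((x - x0) *\<^sub>R F' (x0 + r * (x - x0))) \<le> \<bar>x - x0\<bar> * \<phi>' (r * \<bar>x - x0\<bar>)"
      if r: "0 < r" "r < 1" for r
    proof -
      have "\<bar>x0 + r * (x - x0) - x0\<bar> = r * \<bar>x - x0\<bar>"
        using r by (simp add: abs_mult)
      moreover have "r * \<bar>x - x0\<bar> \<le> \<bar>x - x0\<bar>"
        using r by (simp add: mult_left_le_one_le)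
      ultimately have "norm (F' (x0 + r * (x - x0))) \<le> \<phi>' (r * \<bar>x - x0\<bar>)"
        using le[OF segment_mem_convex[OF S, of r]] r by auto
      then show ?thesis
        by (simp add: mult_left_mono)
    qed
  qed auto
  then show ?thesis
    by (simp add: h_def \<psi>_def)
qed

section \<open>Oriented integrals\<close>

lemma has_vector_derivative_oriented_integral:
  fixes g :: "real \<Rightarrow> 'a::euclidean_space"
    and \<alpha> \<beta> x0 x :: real
  assumes "continuous_on {\<alpha>..\<beta>} g" "x0 \<in> {\<alpha>..\<beta>}" "x \<in> {\<alpha>..\<beta>}"
  shows "((\<lambda>u. LBINT t=x0..u. g t) has_vector_derivative g x) (at x within {\<alpha>..\<beta>})"
  using interval_integral_FTC2[of \<alpha> x0 \<beta> g x] assms by auto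

text \<open>
  Rescaling to the unit interval removes the orientation and the variable end point. Both sides are
  the increment over the unit interval of the antiderivative of \<open>g\<close>, taken along the segment.
\<close>
lemma oriented_integral_eq_integral_unit:
  fixes g :: "real \<Rightarrow> 'a::euclidean_space"
    and \<alpha> \<beta> x0 x :: real
  assumes "continuous_on {\<alpha>..\<beta>} g" "x0 \<in> {\<alpha>..\<beta>}" "x \<in> {\<alpha>..\<beta>}"
  shows "(LBINT t=x0..x. g t) = integral {0..1} (\<lambda>r. (x - x0) *\<^sub>R g (x0 + r * (x - x0)))"
proof -
  define F where "F = (\<lambda>u. LBINT t=x0..u. g t)"
  have "((\<lambda>r. (x - x0) *\<^sub>R g (x0 + r * (x - x0))) has_integral
      F (x0 + 1 * (x - x0)) - F (x0 + 0 * (x - x0))) {0..1}"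
  proof (rule fundamental_theorem_of_calculus[where f="\<lambda>r. F (x0 + r * (x - x0))"])
    show "((\<lambda>r. F (x0 + r * (x - x0))) has_vector_derivative (x - x0) *\<^sub>R g (x0 + r * (x - x0)))
        (at r within {0..1})" if "r \<in> {0..1}" for r
      unfolding F_def
      using assms that
      by (intro has_vector_derivative_along_segment[where S="{\<alpha>..\<beta>}"]
          has_vector_derivative_oriented_integral) auto
  qed simp
  then have "integral {0..1} (\<lambda>r. (x - x0) *\<^sub>R g (x0 + r * (x - x0))) =
      F (x0 + 1 * (x - x0)) - F (x0 + 0 * (x - x0))"
    by (rule integral_unique)
  moreover have "F x0 = 0"
    by (simp add: F_def)
  ultimately show ?thesis
    by (simp add: F_def del: integral_scaleR_right integral_cmul)
qed

text \<open>
  The variable \<open>s\<close> occurs both in the integrand and as an end point. On the unit interval it is a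
  parameter of the integrand alone, so the integral over a fixed interval of a jointly continuous
  integrand is what has to be continuous.
\<close>
lemma continuous_on_oriented_integral_param:
  fixes k :: "real \<Rightarrow> real \<Rightarrow> 'a::euclidean_space"
    and \<alpha> \<beta> x0 :: real
  assumes k: "continuous_on ({\<alpha>..\<beta>} \<times> {\<alpha>..\<beta>}) (\<lambda>(s, t). k s t)" and x0: "x0 \<in> {\<alpha>..\<beta>}"
  shows "continuous_on {\<alpha>..\<beta>} (\<lambda>s. LBINT t=x0..s. k s t)"
proof -
  let ?m = "\<lambda>p :: real \<times> real. (fst p, x0 + snd p * (fst p - x0))"
  have "continuous_on ({\<alpha>..\<beta>} \<times> {0..1}) (\<lambda>p. (case ?m p of (s, t) \<Rightarrow> k s t))"
  proof (rule continuous_on_compose2[OF k])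
    show "continuous_on ({\<alpha>..\<beta>} \<times> {0..1}) ?m"
      by (intro continuous_intros)
    show "?m ` ({\<alpha>..\<beta>} \<times> {0..1}) \<subseteq> {\<alpha>..\<beta>} \<times> {\<alpha>..\<beta>}"
      using segment_mem_convex[of "{\<alpha>..\<beta>}" x0] x0 by fastforce
  qed
  then have "continuous_on ({\<alpha>..\<beta>} \<times> cbox 0 1) (\<lambda>(s, r). (s - x0) *\<^sub>R k s (x0 + r * (s - x0)))"
    by (auto simp: case_prod_beta intro!: continuous_intros)
  then have "continuous_on {\<alpha>..\<beta>}
      (\<lambda>s. integral (cbox 0 1) (\<lambda>r. (s - x0) *\<^sub>R k s (x0 + r * (s - x0))))"
    by (rule integral_continuous_on_param)
  moreover have eq: "(LBINT t=x0..s. k s t) =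
      integral (cbox 0 1) (\<lambda>r. (s - x0) *\<^sub>R k s (x0 + r * (s - x0)))" if s: "s \<in> {\<alpha>..\<beta>}" for s
  proof -
    have "continuous_on {\<alpha>..\<beta>} (\<lambda>t. (\<lambda>(s, t). k s t) (s, t))"
      using s by (intro continuous_on_compose2[OF k] continuous_intros) auto
    then show ?thesis
      using oriented_integral_eq_integral_unit[of \<alpha> \<beta> "k s" x0 s] s x0 by simp
  qed
  ultimately show ?thesis
    by (simp only: continuous_on_cong[OF refl eq])
qed

text \<open>
  The difference of the two sides has derivative zero, hence increment at most zero.
\<close>
lemma solution_eq_integral:
  fixes y :: "real \<Rightarrow> 'a::euclidean_space"
    and \<alpha> \<beta> x0 x :: real
  assumes g: "continuous_on {\<alpha>..\<beta>} g" and x0: "x0 \<in> {\<alpha>..\<beta>}" and x: "x \<in> {\<alpha>..\<beta>}"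
    and y: "\<And>t. t \<in> {\<alpha>..\<beta>} \<Longrightarrow> (y has_vector_derivative g t) (at t within {\<alpha>..\<beta>})"
  shows "y x = y x0 + (LBINT t=x0..x. g t)"
proof -
  let ?F = "\<lambda>u. y u - (LBINT t=x0..u. g t)"
  have "norm (?F x - ?F x0) \<le> (\<lambda>_. 0) \<bar>x - x0\<bar> - (\<lambda>_. 0) (0::real)"
  proof (rule increment_bound_radial[where S="{\<alpha>..\<beta>}" and F'="\<lambda>_. 0" and \<phi>'="\<lambda>_. 0"])
    show "(?F has_vector_derivative 0) (at t within {\<alpha>..\<beta>})" if "t \<in> {\<alpha>..\<beta>}" for t
      using has_vector_derivative_diff[OF y[OF that] has_vector_derivative_oriented_integral[OF g x0 that]]
      by simp
  qed (use x0 x in auto)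
  then show ?thesis
    by (simp add: diff_eq_eq)
qed

section \<open>Initial value problems with a causal Lipschitz right-hand side\<close>

text \<open>
  The Lipschitz condition measures the distance of \<open>y\<close> and \<open>z\<close> only up to the distance of \<open>s\<close>
  from \<open>x0\<close>. Without this restriction (a right-hand side that looks ahead, say) the initial value
  problem need not be solvable on the whole interval.
\<close>
locale causal_lipschitz =
  fixes G :: "(real \<Rightarrow> 'a::euclidean_space) \<Rightarrow> real \<Rightarrow> 'a"
    and \<alpha> \<beta> x0 M :: real
  assumes x0: "x0 \<in> {\<alpha>..\<beta>}" and M: "0 < M"
    and G_cont: "\<And>y. continuous_on {\<alpha>..\<beta>} y \<Longrightarrow> continuous_on {\<alpha>..\<beta>} (G y)"
    and G_lip: "\<And>y z s d. continuous_on {\<alpha>..\<beta>} y \<Longrightarrow> continuous_on {\<alpha>..\<beta>} z \<Longrightarrow> s \<in> {\<alpha>..\<beta>} \<Longrightarrow>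
           (\<And>t. t \<in> {\<alpha>..\<beta>} \<Longrightarrow> \<bar>t - x0\<bar> \<le> \<bar>s - x0\<bar> \<Longrightarrow> norm (y t - z t) \<le> d) \<Longrightarrow>
           norm (G y s - G z s) \<le> M * d"
begin

text \<open>
  The weight increases with the distance from \<open>x0\<close>, so on the part of the interval that \<open>G\<close> sees
  at \<open>s\<close> it is largest at \<open>s\<close>. Hence \<open>G y\<close> and \<open>G z\<close> differ at \<open>s\<close> by at most \<open>M * D\<close> times
  the weight at \<open>s\<close>. An antiderivative of this bound in the distance is \<open>D / 2\<close> times the weight:
  the exponent \<open>2 * M\<close> is chosen to make the factor one half.
\<close>
lemma bielecki_contraction:
  assumes y: "continuous_on {\<alpha>..\<beta>} y" and z: "continuous_on {\<alpha>..\<beta>} z" and D: "0 \<le> D"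
    and yz: "\<And>t. t \<in> {\<alpha>..\<beta>} \<Longrightarrow> norm (y t - z t) \<le> D * exp (2 * M * \<bar>t - x0\<bar>)"
    and x: "x \<in> {\<alpha>..\<beta>}"
  shows "norm ((LBINT s=x0..x. G y s) - (LBINT s=x0..x. G z s)) \<le> D / 2 * exp (2 * M * \<bar>x - x0\<bar>)"
proof -
  let ?F = "\<lambda>u. (LBINT s=x0..u. G y s) - (LBINT s=x0..u. G z s)"
  let ?\<phi> = "\<lambda>r. D / 2 * exp (2 * M * r)"
  have "norm (?F x - ?F x0) \<le> ?\<phi> \<bar>x - x0\<bar> - ?\<phi> 0"
  proof (rule increment_bound_radial[where S="{\<alpha>..\<beta>}"])
    show "(?F has_vector_derivative (G y t - G z t)) (at t within {\<alpha>..\<beta>})" if "t \<in> {\<alpha>..\<beta>}" for t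
      using that x0 y z
      by (intro has_vector_derivative_diff has_vector_derivative_oriented_integral G_cont)
    show "(?\<phi> has_real_derivative M * (D * exp (2 * M * r))) (at r)" for r
      by (auto intro!: derivative_eq_intros)
    show "norm (G y s - G z s) \<le> M * (D * exp (2 * M * \<bar>s - x0\<bar>))" if "s \<in> {\<alpha>..\<beta>}" for s
    proof (rule G_lip[OF y z that])
      fix t assume t: "t \<in> {\<alpha>..\<beta>}" "\<bar>t - x0\<bar> \<le> \<bar>s - x0\<bar>"
      have "D * exp (2 * M * \<bar>t - x0\<bar>) \<le> D * exp (2 * M * \<bar>s - x0\<bar>)"
        using t M D by (intro mult_left_mono) auto
      with yz[OF t(1)] show "norm (y t - z t) \<le> D * exp (2 * M * \<bar>s - x0\<bar>)"
        by linarith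
    qed
  qed (use x0 x in auto)
  then show ?thesis
    using D by simp
qed

text \<open>
  Banach's theorem is applied to bounded continuous functions on the whole line with their supremum
  norm, which form a complete space. A function \<open>u\<close> there represents \<open>lift u\<close>, the product of \<open>u\<close>
  with the weight, so that the supremum norm of \<open>u\<close> dominates the Bielecki norm of \<open>lift u\<close>.
\<close>
lemma ivp_exists:
  obtains y where "y x0 = y0"
    "\<And>x. x \<in> {\<alpha>..\<beta>} \<Longrightarrow> (y has_vector_derivative G y x) (at x within {\<alpha>..\<beta>})"
proof -
  define w where "w = (\<lambda>t. exp (2 * M * \<bar>t - x0\<bar>))"
  define lift where "lift = (\<lambda>(u :: real \<Rightarrow>\<^sub>C 'a) t. w t *\<^sub>R u t)"
  define P where "P = (\<lambda>y (x::real). y0 + (LBINT s=x0..x. G y s))"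
  have w_pos: "0 < w t" for t
    by (simp add: w_def)
  have w_cont: "continuous_on A w" for A
    unfolding w_def by (intro continuous_intros)
  have lift_cont: "continuous_on A (lift u)" for A u
    unfolding lift_def by (intro continuous_intros w_cont continuous_on_apply_bcontfun)
  have dP: "(P y has_vector_derivative G y x) (at x within {\<alpha>..\<beta>})"
    if "continuous_on {\<alpha>..\<beta>} y" "x \<in> {\<alpha>..\<beta>}" for x y
  proof -
    have "((\<lambda>u. LBINT s=x0..u. G y s) has_vector_derivative G y x) (at x within {\<alpha>..\<beta>})"
      using that x0 by (intro has_vector_derivative_oriented_integral G_cont)
    then show ?thesis
      unfolding P_def by (auto intro!: derivative_eq_intros)
  qed
  \<comment> \<open>\<open>P\<close> is meaningful on the interval only. Clamping extends its values by constants to a bounded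
    continuous function on the line without enlarging the distance of two images.\<close>
  have "\<exists>v :: real \<Rightarrow>\<^sub>C 'a. \<forall>x. v x = P (lift u) (clamp \<alpha> \<beta> x) /\<^sub>R w (clamp \<alpha> \<beta> x)" for u
  proof -
    have "continuous_on {\<alpha>..\<beta>} (P (lift u))"
      by (rule continuous_on_vector_derivative[OF dP[OF lift_cont]])
    then have "continuous_on (cbox \<alpha> \<beta>) (\<lambda>x. P (lift u) x /\<^sub>R w x)"
      using w_pos by (auto intro!: continuous_intros w_cont simp: less_imp_neq[symmetric])
    then show ?thesis
      by (rule continuous_on_cbox_bcontfunE) metis
  qed
  then obtain T :: "(real \<Rightarrow>\<^sub>C 'a) \<Rightarrow> (real \<Rightarrow>\<^sub>C 'a)"
    where T: "\<And>u x. T u x = P (lift u) (clamp \<alpha> \<beta> x) /\<^sub>R w (clamp \<alpha> \<beta> x)"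
    by metis
  have "dist (T u) (T v) \<le> 1 / 2 * dist u v" for u v
  proof (rule dist_bound)
    fix x
    define c where "c = clamp \<alpha> \<beta> x"
    have c: "c \<in> {\<alpha>..\<beta>}"
      using clamp_in_interval[of \<alpha> \<beta> x] x0 by (auto simp: c_def)
    have lift_le: "norm (lift u t - lift v t) \<le> dist u v * w t" for t
    proof -
      have "norm (lift u t - lift v t) = w t * dist (u t) (v t)"
        using w_pos[of t] by (simp add: lift_def dist_norm scaleR_diff_right[symmetric])
      also have "\<dots> \<le> w t * dist u v"
        using w_pos[of t] by (intro mult_left_mono dist_bounded) auto
      finally show ?thesis
        by (simp add: mult.commute)
    qed
    have "norm ((LBINT s=x0..c. G (lift u) s) - (LBINT s=x0..c. G (lift v) s))
        \<le> dist u v / 2 * exp (2 * M * \<bar>c - x0\<bar>)"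
      using bielecki_contraction[OF lift_cont lift_cont zero_le_dist lift_le[unfolded w_def] c] .
    then have "norm (P (lift u) c - P (lift v) c) \<le> dist u v / 2 * w c"
      by (simp add: P_def w_def)
    then have "norm (P (lift u) c - P (lift v) c) / w c \<le> 1 / 2 * dist u v"
      using w_pos[of c] by (simp add: pos_divide_le_eq)
    moreover have "dist (T u x) (T v x) = norm (P (lift u) c - P (lift v) c) / w c"
      using w_pos[of c]
      by (simp add: T c_def[symmetric] dist_norm scaleR_diff_right[symmetric]
          divide_inverse mult.commute del: scaleR_diff_right)
    ultimately show "dist (T u x) (T v x) \<le> 1 / 2 * dist u v"
      by simp
  qed
  then obtain u where u: "T u = u"
    using banach_fix_type[of "1/2" T] by auto
  define y where "y = lift u"
  have y_cont: "continuous_on {\<alpha>..\<beta>} y"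
    unfolding y_def by (rule lift_cont)
  have fixed_point: "y x = P y x" if x: "x \<in> {\<alpha>..\<beta>}" for x
  proof -
    have "y x = w x *\<^sub>R T u x"
      by (simp add: y_def lift_def u)
    then show ?thesis
      using x w_pos[of x] by (simp add: T y_def)
  qed
  show ?thesis
  proof
    show "y x0 = y0"
      using fixed_point[OF x0] by (simp add: P_def)
    show "(y has_vector_derivative G y x) (at x within {\<alpha>..\<beta>})" if "x \<in> {\<alpha>..\<beta>}" for x
      using has_vector_derivative_transform[OF that fixed_point dP[OF y_cont that]] .
  qed
qed

text \<open>
  The continuous function \<open>norm (y t - z t) / w t\<close> attains its maximum \<open>D\<close> on the compact interval,
  and the contraction estimate at the maximum point gives \<open>D \<le> D / 2\<close>.
\<close>
lemma ivp_unique: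
  assumes y: "\<And>x. x \<in> {\<alpha>..\<beta>} \<Longrightarrow> (y has_vector_derivative G y x) (at x within {\<alpha>..\<beta>})"
    and z: "\<And>x. x \<in> {\<alpha>..\<beta>} \<Longrightarrow> (z has_vector_derivative G z x) (at x within {\<alpha>..\<beta>})"
    and init: "y x0 = z x0" and x: "x \<in> {\<alpha>..\<beta>}"
  shows "y x = z x"
proof -
  define w where "w = (\<lambda>t. exp (2 * M * \<bar>t - x0\<bar>))"
  have w_pos: "0 < w t" for t
    by (simp add: w_def)
  have cont: "continuous_on {\<alpha>..\<beta>} y" "continuous_on {\<alpha>..\<beta>} z"
    using continuous_on_vector_derivative[OF y] continuous_on_vector_derivative[OF z] by simp_all
  have diff: "y t - z t = (LBINT s=x0..t. G y s) - (LBINT s=x0..t. G z s)" if "t \<in> {\<alpha>..\<beta>}" for t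
    using solution_eq_integral[OF G_cont[OF cont(1)] x0 that y]
      solution_eq_integral[OF G_cont[OF cont(2)] x0 that z] init by simp
  have "continuous_on {\<alpha>..\<beta>} (\<lambda>t. norm (y t - z t) / w t)"
    unfolding w_def by (intro continuous_intros cont) auto
  then obtain m where m: "m \<in> {\<alpha>..\<beta>}"
    and max: "\<And>t. t \<in> {\<alpha>..\<beta>} \<Longrightarrow> norm (y t - z t) / w t \<le> norm (y m - z m) / w m"
    using continuous_attains_sup[of "{\<alpha>..\<beta>}" "\<lambda>t. norm (y t - z t) / w t"] x0 by auto
  define D where "D = norm (y m - z m) / w m"
  have le: "norm (y t - z t) \<le> D * w t" if "t \<in> {\<alpha>..\<beta>}" for t
    using max[OF that] w_pos[of t] by (simp add: D_def[symmetric] pos_divide_le_eq)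
  have D0: "0 \<le> D"
    using w_pos[of m] by (simp add: D_def)
  have "norm (y m - z m) \<le> D / 2 * w m"
    unfolding diff[OF m] w_def
    using bielecki_contraction[OF cont D0 le[unfolded w_def] m] .
  moreover have "norm (y m - z m) = D * w m"
    using w_pos[of m] by (simp add: D_def)
  ultimately have "D * w m \<le> 0"
    by simp
  with D0 w_pos[of m] have "D = 0"
    by (simp add: mult_le_0_iff)
  with le[OF x] show ?thesis
    by simp
qed

end

section \<open>Lipschitz conditions in an arbitrary norm\<close>

text \<open>
  Expanding \<open>v\<close> in the basis bounds \<open>N v\<close> by a multiple of the Euclidean norm. So \<open>N\<close> is Lipschitz,
  hence continuous, and attains on the compact unit sphere a minimum, which is positive since the
  minimiser is not zero. Homogeneity carries the bound from the sphere to all vectors.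
\<close>
lemma is_norm_equivalent:
  fixes N :: "'a::euclidean_space \<Rightarrow> real"
  assumes "is_norm N"
  obtains c C where "0 < c" "0 < C" "\<And>v. N v \<le> C * norm v" "\<And>v. norm v \<le> c * N v"
proof -
  have nonneg: "0 \<le> N v" and zero: "N v = 0 \<longleftrightarrow> v = 0" and scale: "N (r *\<^sub>R v) = \<bar>r\<bar> * N v"
    and tri: "N (v + w) \<le> N v + N w" for v w r
    using assms by (auto simp: is_norm_def)
  \<comment> \<open>Adding 1 makes the constant visibly positive.\<close>
  define C where "C = (\<Sum>b\<in>Basis. N b) + 1"
  have C: "0 < C"
    unfolding C_def using sum_nonneg[of Basis N] nonneg by (simp add: add_nonneg_pos)
  have N_sum: "N (\<Sum>b\<in>B. h b) \<le> (\<Sum>b\<in>B. N (h b))" if "finite B" for B and h :: "'a \<Rightarrow> 'a"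
    using that
  proof (induction B rule: finite_induct)
    case empty
    then show ?case using zero[of 0] by simp
  next
    case (insert b B)
    then show ?case using tri[of "h b" "sum h B"] by simp
  qed
  have upper: "N v \<le> C * norm v" for v
  proof -
    have "N v = N (\<Sum>b\<in>Basis. (v \<bullet> b) *\<^sub>R b)"
      by (simp add: euclidean_representation)
    also have "\<dots> \<le> (\<Sum>b\<in>Basis. \<bar>v \<bullet> b\<bar> * N b)"
      using N_sum[of Basis "\<lambda>b. (v \<bullet> b) *\<^sub>R b"] by (simp add: scale)
    also have "\<dots> \<le> (\<Sum>b\<in>Basis. norm v * N b)"
      by (intro sum_mono mult_right_mono nonneg) (simp add: Basis_le_norm)
    also have "\<dots> \<le> C * norm v"
      by (simp add: C_def sum_distrib_left[symmetric] distrib_left mult.commute[of _ "norm v"])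
    finally show ?thesis .
  qed
  have "\<bar>N v - N w\<bar> \<le> C * norm (v - w)" for v w
  proof -
    have "N v \<le> N w + N (v - w)" "N w \<le> N v + N (w - v)"
      using tri[of w "v - w"] tri[of v "w - v"] by simp_all
    then show ?thesis
      using upper[of "v - w"] upper[of "w - v"] by (simp add: norm_minus_commute)
  qed
  then have "C-lipschitz_on UNIV N"
    using C by (intro lipschitz_onI) (auto simp: dist_norm)
  then have cont: "continuous_on (sphere 0 1) N"
    using lipschitz_on_continuous_on continuous_on_subset by blast
  have "\<exists>p\<in>sphere (0::'a) 1. \<forall>q\<in>sphere 0 1. N p \<le> N q"
    by (intro continuous_attains_inf cont) auto
  then obtain p where p: "norm p = 1" and min: "\<And>q. norm q = 1 \<Longrightarrow> N p \<le> N q"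
    by auto
  have Np: "0 < N p"
    using p zero[of p] nonneg[of p] by (cases "p = 0") auto
  have "norm v \<le> 1 / N p * N v" for v
  proof (cases "v = 0")
    case False
    then have "N p \<le> N v / norm v"
      using min[of "v /\<^sub>R norm v"] by (simp add: scale field_simps)
    then show ?thesis
      using False Np by (simp add: field_simps)
  qed (simp add: nonneg zero)
  with Np C upper show thesis
    by (intro that[of "1 / N p" C]) auto
qed

text \<open>
  One constant \<open>B\<close> serves all \<open>L\<close>, hence \<open>f\<close> and \<open>K\<close> together. The absolute value of \<open>L\<close> keeps the
  new Lipschitz constant nonnegative when \<open>L\<close> is negative.
\<close>
lemma lipschitz_is_norm_imp_norm:
  fixes N :: "'a::euclidean_space \<Rightarrow> real"
  assumes "is_norm N"
  obtains B where "0 < B"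
    "\<And>u v L. N u \<le> L * N v \<Longrightarrow> norm u \<le> B * \<bar>L\<bar> * norm v"
proof -
  obtain c C where c: "0 < c" and C: "0 < C" and up: "\<And>v. N v \<le> C * norm v"
    and low: "\<And>v. norm v \<le> c * N v"
    by (rule is_norm_equivalent[OF assms]) (rule that)
  show thesis
  proof
    show "0 < c * C"
      using c C by simp
    fix u v :: 'a and L :: real
    assume "N u \<le> L * N v"
    also have "\<dots> \<le> \<bar>L\<bar> * N v"
      using assms by (intro mult_right_mono) (auto simp: is_norm_def)
    also have "\<dots> \<le> \<bar>L\<bar> * (C * norm v)"
      by (intro mult_left_mono up) simp
    finally have "c * N u \<le> c * (\<bar>L\<bar> * (C * norm v))"
      using c by simp
    with low[of u] show "norm u \<le> c * C * \<bar>L\<bar> * norm v"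
      by (simp add: mult_ac)
  qed
qed

section \<open>The Volterra right-hand side\<close>

lemma volterra_rhs_continuous:
  fixes f :: "real \<Rightarrow> 'a::euclidean_space \<Rightarrow> 'a" and K :: "real \<Rightarrow> real \<Rightarrow> 'a \<Rightarrow> 'a"
    and \<alpha> \<beta> x0 :: real
  assumes f: "continuous_on ({\<alpha>..\<beta>} \<times> UNIV) (\<lambda>(x, y). f x y)"
    and K: "continuous_on ({\<alpha>..\<beta>} \<times> {\<alpha>..\<beta>} \<times> UNIV) (\<lambda>(x, t, y). K x t y)"
    and x0: "x0 \<in> {\<alpha>..\<beta>}" and y: "continuous_on {\<alpha>..\<beta>} y"
  shows "continuous_on {\<alpha>..\<beta>} (\<lambda>x. f x (y x) + (LBINT t=x0..x. K x t (y t)))"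
proof (rule continuous_on_add)
  have "continuous_on {\<alpha>..\<beta>} (\<lambda>x. (\<lambda>(x, y). f x y) (x, y x))"
    by (intro continuous_on_compose2[OF f] continuous_intros y) auto
  then show "continuous_on {\<alpha>..\<beta>} (\<lambda>x. f x (y x))"
    by simp
  have "continuous_on ({\<alpha>..\<beta>} \<times> {\<alpha>..\<beta>}) (\<lambda>p. (\<lambda>(x, t, y). K x t y) (fst p, snd p, y (snd p)))"
    by (intro continuous_on_compose2[OF K] continuous_intros continuous_on_compose2[OF y]) auto
  then have "continuous_on ({\<alpha>..\<beta>} \<times> {\<alpha>..\<beta>}) (\<lambda>(x, t). K x t (y t))"
    by (simp add: case_prod_beta)
  then show "continuous_on {\<alpha>..\<beta>} (\<lambda>x. LBINT t=x0..x. K x t (y t))"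
    using x0 by (rule continuous_on_oriented_integral_param)
qed

text \<open>
  For fixed \<open>s\<close>, the integrands differ by at most \<open>B * d\<close> between \<open>x0\<close> and \<open>s\<close>, so the integrals
  differ by at most \<open>B * d * \<bar>s - x0\<bar>\<close>. This distance is at most the length of the interval.
\<close>
lemma volterra_rhs_lipschitz:
  fixes f :: "real \<Rightarrow> 'a::euclidean_space \<Rightarrow> 'a" and K :: "real \<Rightarrow> real \<Rightarrow> 'a \<Rightarrow> 'a"
    and \<alpha> \<beta> x0 s :: real
  assumes K: "continuous_on ({\<alpha>..\<beta>} \<times> {\<alpha>..\<beta>} \<times> UNIV) (\<lambda>(x, t, y). K x t y)"
    and f_lip: "\<And>x u v. x \<in> {\<alpha>..\<beta>} \<Longrightarrow> norm (f x u - f x v) \<le> A * norm (u - v)"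
    and K_lip: "\<And>x t u v. x \<in> {\<alpha>..\<beta>} \<Longrightarrow> t \<in> {\<alpha>..\<beta>} \<Longrightarrow>
           norm (K x t u - K x t v) \<le> B * norm (u - v)"
    and AB: "0 \<le> A" "0 \<le> B"
    and x0: "x0 \<in> {\<alpha>..\<beta>}" and s: "s \<in> {\<alpha>..\<beta>}"
    and y: "continuous_on {\<alpha>..\<beta>} y" and z: "continuous_on {\<alpha>..\<beta>} z"
    and d: "\<And>t. t \<in> {\<alpha>..\<beta>} \<Longrightarrow> \<bar>t - x0\<bar> \<le> \<bar>s - x0\<bar> \<Longrightarrow> norm (y t - z t) \<le> d"
  shows "norm ((f s (y s) + (LBINT t=x0..s. K s t (y t))) - (f s (z s) + (LBINT t=x0..s. K s t (z t))))
           \<le> (A + B * (\<beta> - \<alpha>)) * d"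
proof -
  have d0: "0 \<le> d"
    using d[OF s] norm_ge_zero[of "y s - z s"] by linarith
  have K_cont: "continuous_on {\<alpha>..\<beta>} (\<lambda>t. K s t (u t))" if u: "continuous_on {\<alpha>..\<beta>} u" for u
  proof -
    have "continuous_on {\<alpha>..\<beta>} (\<lambda>t. (\<lambda>(x, t, y). K x t y) (s, t, u t))"
      using s by (intro continuous_on_compose2[OF K] continuous_intros u) auto
    then show ?thesis
      by simp
  qed
  let ?F = "\<lambda>x. (LBINT t=x0..x. K s t (y t)) - (LBINT t=x0..x. K s t (z t))"
  have "norm (?F s - ?F x0) \<le> (\<lambda>r. B * d * r) \<bar>s - x0\<bar> - (\<lambda>r. B * d * r) 0"
  proof (rule increment_bound_radial[where S="{\<alpha>..\<beta>}"])
    show "(?F has_vector_derivative (K s t (y t) - K s t (z t))) (at t within {\<alpha>..\<beta>})"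
      if "t \<in> {\<alpha>..\<beta>}" for t
      using that x0 by (intro has_vector_derivative_diff has_vector_derivative_oriented_integral K_cont y z)
    show "((\<lambda>r. B * d * r) has_real_derivative B * d) (at r)" for r
      by (auto intro!: derivative_eq_intros)
    show "norm (K s t (y t) - K s t (z t)) \<le> B * d"
      if "t \<in> {\<alpha>..\<beta>}" "\<bar>t - x0\<bar> \<le> \<bar>s - x0\<bar>" for t
      using K_lip[OF s that(1), of "y t" "z t"] mult_left_mono[OF d[OF that] AB(2)] by linarith
  qed (use x0 s in auto)
  also have "\<dots> \<le> B * d * (\<beta> - \<alpha>)"
    using mult_left_mono[OF _ mult_nonneg_nonneg[OF AB(2) d0], of "\<bar>s - x0\<bar>" "\<beta> - \<alpha>"] x0 s by auto
  finally have "norm (?F s) \<le> B * d * (\<beta> - \<alpha>)"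
    by simp
  moreover have "norm (f s (y s) - f s (z s)) \<le> A * d"
    using f_lip[OF s, of "y s" "z s"] mult_left_mono[OF d[OF s order_refl] AB(1)] by linarith
  ultimately have "norm ((f s (y s) - f s (z s)) + ?F s) \<le> A * d + B * d * (\<beta> - \<alpha>)"
    by (intro norm_triangle_mono)
  then show ?thesis
    by (simp add: algebra_simps)
qed

section \<open>Existence and uniqueness for the Volterra equation\<close>

theorem theorem2p3:
  fixes f :: "real \<Rightarrow> real ^ 'n \<Rightarrow> real ^ 'n"
    and K :: "real \<Rightarrow> real \<Rightarrow> real ^ 'n \<Rightarrow> real ^ 'n"
    and N :: "real ^ 'n \<Rightarrow> real"
    and a x0 L1 L2 :: real
    and y0 :: "real ^ 'n"
  assumes "a > 0"
    and "is_norm N"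
    and "continuous_on ({x0 - a..x0 + a} \<times> UNIV) (\<lambda>(x, y). f x y)"
    and "continuous_on ({x0 - a..x0 + a} \<times> {x0 - a..x0 + a} \<times> UNIV) (\<lambda>(x, t, y). K x t y)"
    and "\<And>x y1 y2. \<bar>x - x0\<bar> \<le> a \<Longrightarrow> N (f x y1 - f x y2) \<le> L1 * N (y1 - y2)"
    and "\<And>x t y1 y2. \<bar>x - x0\<bar> \<le> a \<Longrightarrow> \<bar>t - x0\<bar> \<le> a \<Longrightarrow>
           N (K x t y1 - K x t y2) \<le> L2 * N (y1 - y2)"
  shows "(\<exists>y. volterra_ide_solution f K x0 y0 a y) \<and>
         (\<forall>y z. volterra_ide_solution f K x0 y0 a y \<longrightarrow> volterra_ide_solution f K x0 y0 a z \<longrightarrow>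
            (\<forall>x\<in>{x0 - a..x0 + a}. y x = z x))"
proof -
  let ?S = "{x0 - a..x0 + a}"
  define G where "G = (\<lambda>y x. f x (y x) + (LBINT t=x0..x. K x t (y t)))"
  have x0: "x0 \<in> ?S"
    using assms(1) by simp
  have S: "\<bar>x - x0\<bar> \<le> a" if "x \<in> ?S" for x
    using that by auto
  obtain B where B: "0 < B" "\<And>u v L. N u \<le> L * N v \<Longrightarrow> norm u \<le> B * \<bar>L\<bar> * norm v"
    by (rule lipschitz_is_norm_imp_norm[OF assms(2)]) (rule that)
  define M where "M = B * \<bar>L1\<bar> + B * \<bar>L2\<bar> * ((x0 + a) - (x0 - a))"
  have M0: "0 \<le> M"
    using B(1) assms(1) by (simp add: M_def)
  have G_cont: "continuous_on ?S (G y)" if "continuous_on ?S y" for y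
    unfolding G_def using volterra_rhs_continuous[OF assms(3,4) x0 that] .
  \<comment> \<open>\<open>M\<close> may vanish, but the exponent of the weight must be positive: hence \<open>M + 1\<close>.\<close>
  have G_lip: "norm (G y s - G z s) \<le> (M + 1) * d"
    if "continuous_on ?S y" "continuous_on ?S z" and s: "s \<in> ?S"
      and d: "\<And>t. t \<in> ?S \<Longrightarrow> \<bar>t - x0\<bar> \<le> \<bar>s - x0\<bar> \<Longrightarrow> norm (y t - z t) \<le> d"
    for y z s d
  proof -
    have "0 \<le> d"
      using d[OF s] norm_ge_zero[of "y s - z s"] by linarith
    moreover have "norm (G y s - G z s) \<le> M * d"
      unfolding G_def M_def
    proof (rule volterra_rhs_lipschitz[OF assms(4)])
      show "norm (f x u - f x v) \<le> B * \<bar>L1\<bar> * norm (u - v)" if "x \<in> ?S" for x u v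
        using B(2)[OF assms(5)[OF S[OF that]]] .
      show "norm (K x t u - K x t v) \<le> B * \<bar>L2\<bar> * norm (u - v)" if "x \<in> ?S" "t \<in> ?S" for x t u v
        using B(2)[OF assms(6)[OF S[OF that(1)] S[OF that(2)]]] .
    qed (use B(1) that x0 in auto)
    ultimately show ?thesis
      by (simp add: algebra_simps)
  qed
  have sol: "volterra_ide_solution f K x0 y0 a y \<longleftrightarrow>
      y x0 = y0 \<and> (\<forall>x\<in>?S. (y has_vector_derivative G y x) (at x within ?S))" for y
    by (simp add: volterra_ide_solution_def G_def)
  have M: "0 < M + 1"
    using M0 by simp
  interpret causal_lipschitz G "x0 - a" "x0 + a" x0 "M + 1"
    by unfold_locales (fact x0 M G_cont G_lip)+
  obtain y where "y x0 = y0" "\<And>x. x \<in> ?S \<Longrightarrow> (y has_vector_derivative G y x) (at x within ?S)"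
    by (rule ivp_exists) (rule that)
  then have "volterra_ide_solution f K x0 y0 a y"
    by (simp add: sol)
  moreover have "u x = v x"
    if "volterra_ide_solution f K x0 y0 a u" "volterra_ide_solution f K x0 y0 a v" "x \<in> ?S" for u v x
    using that ivp_unique[of u v x] by (simp add: sol)
  ultimately show ?thesis
    by blast
qed

end
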